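(* Let $f_1,f_2,\dots$ be independent random variables taking values in $\{0,1\}$, with \[ \inf_{n\ge1}\min\{\Pr[f_n=0],\Pr[f_n=1]\}>0, \] and set $f_0=1$ and $\mathcal{F}(q)=\sum_{n\ge0}f_nq^n\in\mathbb{F}_2[[q]]$. Let $\bar{\mathcal{F}}(q)=\sum_{n\ge0}\bar f_n q^n$ be the inverse of $\mathcal{F}(q)$ in $\mathbb{F}_2[[q]]$ and $\bar F=\{n\ge0:\bar f_n=1\}$. Then, with probability $1$, the limit $\delta(\bar F)=\lim_{n\to\infty}\frac{|\bar F\cap[0,n]|}{n+1}$ exists and equals $1/2$.
   Context: $\mathbb{F}_2[[q]]$ is the ring of formal power series over the two-element field; a power series with constant term $1$ is invertible there. *)

theory Defs
  imports
    "HOL-Probability.Probability"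
    "HOL-Computational_Algebra.Formal_Power_Series"
    "HOL-Library.Z2"
begin

definition has_natural_density :: "nat set \<Rightarrow> real \<Rightarrow> bool" where
  "has_natural_density A d \<longleftrightarrow>
     (\<lambda>n. real (card (A \<inter> {0..n})) / (real n + 1)) \<longlonglongrightarrow> d"

text \<open>\<^typ>\<open>bit\<close> is the two-element field, so \<^typ>\<open>bit fps\<close> is the ring of power
  series over it. The coefficients \<open>a 1, a 2, \<dots>\<close> are the given ones; the constant term
  is \<open>1\<close> regardless of the value of \<open>a 0\<close>.\<close>

definition unit_series :: "(nat \<Rightarrow> bit) \<Rightarrow> bit fps" where
  "unit_series a = Abs_fps (\<lambda>n. if n = 0 then 1 else a n)"

definition inverse_support :: "(nat \<Rightarrow> bit) \<Rightarrow> nat set" where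
  "inverse_support a = {n. fps_nth (inverse (unit_series a)) n = 1}"

text \<open>Sanity check: the total library function \<^const>\<open>inverse\<close> is the genuine ring inverse
  on these series.\<close>

lemma unit_series_inverse: "unit_series a * inverse (unit_series a) = 1"
  by (rule inverse_mult_eq_1') (simp add: unit_series_def)

end

theory Submission
  imports Defs "HOL-Library.Discrete_Functions"
begin

text \<open>
  Let \<open>b n\<close> be the coefficients of \<open>1/F\<close> and \<open>X n = (-1)^(b n)\<close>; the density is \<open>1/2\<close> iff the
  averages of \<open>X\<close> tend to \<open>0\<close>. Squaring is the substitution \<open>q \<mapsto> q^2\<close> in characteristic 2, so for
  \<open>m < n \<le> 2 m + 1\<close>, given \<open>f 1, ..., f m\<close>, the bit \<open>b n\<close> is an affine function of the
  later bits in which \<open>f (n - 2 j)\<close> has coefficient \<open>b j\<close>. With \<open>c\<close> a lower bound for all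
  probabilities, the conditional mean of \<open>X n\<close> is therefore at most \<open>(1 - 2 c)^N\<close>, where \<open>N\<close> counts
  the ones among \<open>b j\<close> with \<open>2 j < n - m\<close>. The same fact with \<open>m = n - 1\<close> shows by induction
  that \<open>(1 - 2 c)^N\<close> has mean exponentially small in \<open>n - m\<close>. Taking \<open>m\<close> midway between \<open>i\<close> and \<open>j\<close>,
  the correlation of \<open>X i\<close> and \<open>X j\<close> decays exponentially in \<open>\<bar>i - j\<bar>\<close>, so the partial sums have
  second moment \<open>O(N)\<close>. Summability along the squares gives convergence there, and
  boundedness of \<open>X\<close> fills the gaps.
\<close>

section \<open>Coefficients of the inverse series\<close>

definition inv_coeff :: "(nat \<Rightarrow> bit) \<Rightarrow> nat \<Rightarrow> bit" where
  "inv_coeff a n = fps_nth (inverse (unit_series a)) n"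

text \<open>Index 0 is zeroed as well, since the constant term of the series is fixed; this leaves
  finitely many histories.\<close>

definition truncate_seq :: "nat \<Rightarrow> (nat \<Rightarrow> bit) \<Rightarrow> nat \<Rightarrow> bit" where
  "truncate_seq m a = (\<lambda>i. if i \<in> {1..m} then a i else 0)"

text \<open>The nontrivial additive character, which turns sums of bits into products of
  signs.\<close>

definition bit_sign :: "bit \<Rightarrow> real" where
  "bit_sign x = (if x = 0 then 1 else - 1)"

lemma bit_sign_0 [simp]: "bit_sign 0 = 1"
  by (simp add: bit_sign_def)

lemma bit_sign_add: "bit_sign (x + y) = bit_sign x * bit_sign y"
  by (cases x; cases y) (simp_all add: bit_sign_def)

lemma abs_bit_sign [simp]: "\<bar>bit_sign x\<bar> = 1"
  by (simp add: bit_sign_def)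

lemma bit_sign_sum: "bit_sign (sum g A) = (\<Prod>x\<in>A. bit_sign (g x))"
proof (induction A rule: infinite_finite_induct)
  case (insert x F)
  then show ?case by (simp only: sum.insert[OF insert.hyps] prod.insert[OF insert.hyps] bit_sign_add)
qed simp_all

text \<open>In characteristic 2 the terms at \<open>i\<close> and \<open>n - i\<close> cancel in
  pairs; the middle term is a square, and bits are idempotent.\<close>

lemma fps_square_nth_bit:
  fixes G :: "bit fps"
  shows "fps_nth (G * G) n = (if even n then fps_nth G (n div 2) else 0)"
proof -
  let ?g = "\<lambda>i. fps_nth G i * fps_nth G (n - i)"
  let ?L = "{i. 2 * i < n}" and ?U = "{i. i \<le> n \<and> n < 2 * i}" and ?E = "{i. 2 * i = n}"
  have fin: "finite ?L" "finite ?U" "finite ?E"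
    by (auto intro: finite_subset[of _ "{..n}"])
  have "fps_nth (G * G) n = sum ?g {0..n}"
    by (simp add: fps_mult_nth)
  also have "{0..n} = (?L \<union> ?U) \<union> ?E" by auto
  also have "sum ?g \<dots> = sum ?g (?L \<union> ?U) + sum ?g ?E"
    using fin by (intro sum.union_disjoint) auto
  also have "sum ?g (?L \<union> ?U) = sum ?g ?L + sum ?g ?U"
    using fin by (intro sum.union_disjoint) auto
  also have "sum ?g ?U = sum ?g ?L"
    by (rule sum.reindex_bij_witness[of _ "\<lambda>i. n - i" "\<lambda>i. n - i"]) (auto simp: mult.commute)
  also have "sum ?g ?L + sum ?g ?L = 0"
    by (cases "sum ?g ?L") simp_all
  also have "sum ?g ?E = (if even n then fps_nth G (n div 2) else 0)"
  proof (cases "even n")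
    case True
    then obtain k where k: "n = 2 * k" by (rule evenE)
    then have "?E = {k}" by auto
    then show ?thesis using k by (cases "fps_nth G k") simp_all
  next
    case False
    then have "?E = {}" by auto
    then show ?thesis using False by simp
  qed
  finally show ?thesis by (simp only: add_0_left)
qed

text \<open>Orders of vanishing add up; \<open>p = 0\<close> covers a first factor about which
  nothing is known.\<close>

lemma fps_mult_nth_eq_0:
  fixes P Q :: "'a::semiring_0 fps"
  assumes "\<And>k. k < p \<Longrightarrow> fps_nth P k = 0" "\<And>k. k < q \<Longrightarrow> fps_nth Q k = 0" "n < p + q"
  shows "fps_nth (P * Q) n = 0"
  unfolding fps_mult_nth
proof (rule sum.neutral, safe)
  fix i assume "i \<in> {0..n}"
  then have "i < p \<or> n - i < q" using assms(3) by auto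
  then show "fps_nth P i * fps_nth Q (n - i) = 0" using assms(1,2) by auto
qed

lemma inverse_unit_series_diff:
  "inverse (unit_series a) - inverse (unit_series a')
    = inverse (unit_series a) * inverse (unit_series a') * (unit_series a' - unit_series a)"
proof -
  let ?G = "inverse (unit_series a)" and ?H = "inverse (unit_series a')"
  have "?G * ?H * (unit_series a' - unit_series a)
      = ?G * (unit_series a' * ?H) - ?H * (unit_series a * ?G)"
    by (simp add: algebra_simps)
  then show ?thesis by (simp add: unit_series_inverse)
qed

text \<open>The two series differ only beyond order \<open>n\<close>, hence so do their
  inverses.\<close>

lemma inv_coeff_cong:
  assumes "\<And>i. i \<in> {1..n} \<Longrightarrow> a i = a' i"
  shows "inv_coeff a n = inv_coeff a' n"
proof -
  have "fps_nth (inverse (unit_series a) - inverse (unit_series a')) n = 0"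
    unfolding inverse_unit_series_diff
    by (rule fps_mult_nth_eq_0[of 0 _ "Suc n"]) (use assms in \<open>auto simp: unit_series_def\<close>)
  then show ?thesis
    by (simp add: inv_coeff_def del: minus_bit_def)
qed

lemma inv_coeff_truncate_seq: "n \<le> m \<Longrightarrow> inv_coeff (truncate_seq m a) n = inv_coeff a n"
  by (rule inv_coeff_cong) (auto simp: truncate_seq_def)

lemma inv_coeff_0 [simp]: "inv_coeff a 0 = 1"
  by (simp add: inv_coeff_def unit_series_def)

text \<open>Write \<open>F = A + D\<close> with \<open>A\<close> the truncation at \<open>m\<close>. Modulo \<open>q^(2 m + 2)\<close> we have
  \<open>1/F = 1/A + D/F^2\<close>, and in characteristic 2 the series \<open>1/F^2\<close> is \<open>1/F\<close> with \<open>q\<close> replaced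
  by \<open>q^2\<close>.\<close>

lemma inv_coeff_affine:
  assumes "m < n" "n \<le> 2 * m + 1"
  shows "inv_coeff a n = inv_coeff (truncate_seq m a) n
           + (\<Sum>j<(n - m + 1) div 2. a (n - 2 * j) * inv_coeff a j)"
proof -
  define F where "F = unit_series a"
  define A where "A = unit_series (truncate_seq m a)"
  define G where "G = inverse F"
  define H where "H = inverse A"
  define D where "D = A - F"
  have D: "fps_nth D k = (if k \<le> m then 0 else a k)" for k
    by (auto simp: D_def A_def F_def unit_series_def truncate_seq_def)
  have GH: "G - H = G * H * D"
    unfolding G_def H_def D_def F_def A_def by (rule inverse_unit_series_diff)
  have low: "fps_nth (H - G) k = 0" if "k < Suc m" for k
  proof -
    have "fps_nth (G - H) k = 0"
      unfolding GH by (rule fps_mult_nth_eq_0[of 0 _ "Suc m"]) (use that in \<open>auto simp: D\<close>)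
    moreover have "fps_nth (H - G) k = - fps_nth (G - H) k"
      by (simp only: fps_sub_nth minus_diff_eq)
    ultimately show ?thesis by (simp only: neg_equal_0_iff_equal)
  qed
  \<comment> \<open>Replacing \<open>H\<close> by \<open>G\<close> produces the square; the error
    term has order at least \<open>2 * m + 2\<close>, which exceeds \<open>n\<close>.\<close>
  have "G - H = G * G * D + (G * (H - G)) * D"
    unfolding GH by (simp add: algebra_simps)
  then have "fps_nth (G - H) n = fps_nth (G * G * D) n + fps_nth ((G * (H - G)) * D) n"
    by (simp only: fps_add_nth)
  also have "fps_nth ((G * (H - G)) * D) n = 0"
  proof (rule fps_mult_nth_eq_0[of "Suc m" _ "Suc m"])
    show "fps_nth (G * (H - G)) k = 0" if "k < Suc m" for k
      by (rule fps_mult_nth_eq_0[of 0 _ "Suc m"]) (use that in \<open>simp_all only: low not_less_zero add_0\<close>)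
  qed (use assms in \<open>auto simp: D\<close>)
  also have "fps_nth (G * G * D) n + 0 = fps_nth (G * G * D) n"
    by (rule add_0_right)
  also have "\<dots> = (\<Sum>i\<in>{0..n}. (if even i then fps_nth G (i div 2) else 0) * fps_nth D (n - i))"
    by (simp add: fps_mult_nth[of "G * G"] fps_square_nth_bit)
  \<comment> \<open>A nonzero term needs \<open>i = 2 * j\<close> and \<open>n - i > m\<close>; the
    latter, \<open>2 * j < n - m\<close>, amounts to \<open>j < (n - m + 1) div 2\<close>.\<close>
  also have "\<dots> = (\<Sum>i\<in>(\<lambda>j. 2 * j) ` {..<(n - m + 1) div 2}.
                  (if even i then fps_nth G (i div 2) else 0) * fps_nth D (n - i))"
  proof (rule sum.mono_neutral_right)
    show "(\<lambda>j. 2 * j) ` {..<(n - m + 1) div 2} \<subseteq> {0..n}" by auto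
    show "\<forall>i\<in>{0..n} - (\<lambda>j. 2 * j) ` {..<(n - m + 1) div 2}.
       (if even i then fps_nth G (i div 2) else 0) * fps_nth D (n - i) = 0"
    proof safe
      fix i assume i: "i \<in> {0..n}" "i \<notin> (\<lambda>j. 2 * j) ` {..<(n - m + 1) div 2}"
      have "odd i \<or> n - i \<le> m"
      proof (rule ccontr)
        assume "\<not> ?thesis"
        then have "i = 2 * (i div 2)" "i div 2 < (n - m + 1) div 2" using i by auto
        then show False using i by blast
      qed
      then show "(if even i then fps_nth G (i div 2) else 0) * fps_nth D (n - i) = 0"
        by (auto simp: D)
    qed
  qed simp
  also have "\<dots> = (\<Sum>j<(n - m + 1) div 2. fps_nth G j * fps_nth D (n - 2 * j))"
    by (subst sum.reindex) (auto simp: inj_on_def)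
  also have "\<dots> = (\<Sum>j<(n - m + 1) div 2. a (n - 2 * j) * inv_coeff a j)"
    by (rule sum.cong) (auto simp: D inv_coeff_def G_def F_def mult.commute)
  finally have diff: "fps_nth G n - fps_nth H n = (\<Sum>j<(n - m + 1) div 2. a (n - 2 * j) * inv_coeff a j)"
    by (simp only: fps_sub_nth)
  have bit: "x = y + (x - y)" for x y :: bit
    by (cases x; cases y) simp_all
  have "inv_coeff a n = fps_nth G n"
    by (simp only: inv_coeff_def G_def F_def)
  also have "\<dots> = fps_nth H n + (fps_nth G n - fps_nth H n)"
    by (rule bit)
  also note diff
  also have "fps_nth H n = inv_coeff (truncate_seq m a) n"
    by (simp only: inv_coeff_def H_def A_def)
  finally show ?thesis .
qed

text \<open>Vanishing coefficients contribute the sign 1. The indices \<open>n - 2 * j\<close> are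
  distinct and exceed \<open>m\<close>, while the set of \<open>j\<close> is determined by the first
  \<open>m\<close> bits, so past and future are separated.\<close>

lemma bit_sign_inv_coeff_split:
  assumes "m < n" "n \<le> 2 * m + 1"
  shows "bit_sign (inv_coeff a n) = bit_sign (inv_coeff (truncate_seq m a) n)
    * (\<Prod>k\<in>(\<lambda>j. n - 2 * j) ` {j. j < (n - m + 1) div 2 \<and> inv_coeff a j = 1}. bit_sign (a k))"
proof -
  let ?J = "{..<(n - m + 1) div 2}"
  have "(\<Prod>j\<in>?J. bit_sign (a (n - 2 * j) * inv_coeff a j))
      = (\<Prod>j\<in>{j. j < (n - m + 1) div 2 \<and> inv_coeff a j = 1}. bit_sign (a (n - 2 * j)))"
    by (rule prod.mono_neutral_cong_right) (auto simp: bit_sign_def)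
  also have "\<dots> = (\<Prod>k\<in>(\<lambda>j. n - 2 * j) ` {j. j < (n - m + 1) div 2 \<and> inv_coeff a j = 1}. bit_sign (a k))"
    by (subst prod.reindex) (auto simp: inj_on_def)
  finally show ?thesis
    by (simp only: inv_coeff_affine[OF assms, of a] bit_sign_add bit_sign_sum)
qed

section \<open>Histories of finite length\<close>

lemma finite_range_truncate_seq: "finite (range (truncate_seq m))"
proof -
  have "range (truncate_seq m) \<subseteq> (\<lambda>S i. if i \<in> S then 1 else 0) ` Pow {1..m}"
  proof safe
    fix a
    have "truncate_seq m a = (\<lambda>i. if i \<in> {i\<in>{1..m}. a i = 1} then 1 else 0)"
      by (auto simp: truncate_seq_def fun_eq_iff)
    then show "truncate_seq m a \<in> (\<lambda>S i. if i \<in> S then 1 else 0) ` Pow {1..m}"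
      by blast
  qed
  then show ?thesis by (rule finite_subset) simp
qed

text \<open>Turns the event of a given history into a finite intersection of single-bit
  events.\<close>

lemma truncate_seq_eq_iff:
  assumes "a \<in> range (truncate_seq m)"
  shows "truncate_seq m x = a \<longleftrightarrow> (\<forall>i\<in>{1..m}. x i = a i)"
proof
  assume "truncate_seq m x = a"
  then show "\<forall>i\<in>{1..m}. x i = a i" by (auto simp: truncate_seq_def)
next
  assume *: "\<forall>i\<in>{1..m}. x i = a i"
  obtain b where "a = truncate_seq m b" using assms by blast
  with * show "truncate_seq m x = a" by (auto simp: truncate_seq_def)
qed

lemma truncate_seq_idem [simp]: "truncate_seq m (truncate_seq m a) = truncate_seq m a"
  by (auto simp: truncate_seq_def)

section \<open>Averages and natural density\<close>

text \<open>With \<open>k = floor_sqrt n\<close>, at most \<open>2 * k\<close> terms lie beyond the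
  first \<open>k^2\<close>; they contribute at most \<open>2 / k\<close> to the average.\<close>

lemma average_tendsto_0_of_squares:
  fixes x :: "nat \<Rightarrow> real"
  assumes bound: "\<And>i. \<bar>x i\<bar> \<le> 1"
    and lim: "(\<lambda>k. (\<Sum>i<k\<^sup>2. x i) / real (k\<^sup>2)) \<longlonglongrightarrow> 0"
  shows "(\<lambda>n. (\<Sum>i<n. x i) / real n) \<longlonglongrightarrow> 0"
proof -
  define T where "T k = \<bar>(\<Sum>i<k\<^sup>2. x i) / real (k\<^sup>2)\<bar> + 2 / real k" for k
  have T_lim: "T \<longlonglongrightarrow> 0 + 0"
    unfolding T_def by (intro tendsto_add tendsto_rabs_zero[OF lim] lim_const_over_n)
  have sqrt_lim: "filterlim floor_sqrt at_top sequentially"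
    unfolding filterlim_at_top eventually_sequentially
  proof (intro allI exI impI)
    fix Z n :: nat assume "Z\<^sup>2 \<le> n"
    then show "Z \<le> floor_sqrt n" by (simp add: le_floor_sqrtI)
  qed
  have T: "(\<lambda>n. T (floor_sqrt n)) \<longlonglongrightarrow> 0"
    using filterlim_compose[OF T_lim sqrt_lim] by simp
  show ?thesis
  proof (rule Lim_null_comparison[OF _ T], rule eventually_sequentiallyI)
    fix n :: nat assume "1 \<le> n"
    define k where "k = floor_sqrt n"
    have k: "k\<^sup>2 \<le> n" "n < (Suc k)\<^sup>2"
      unfolding k_def by (simp_all add: Suc_floor_sqrt_power2_gt)
    have "k > 0" using k \<open>1 \<le> n\<close> by (cases k) auto
    have "n - k\<^sup>2 \<le> 2 * k" using k(2) by (simp add: power2_eq_square)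
    have "(\<Sum>i<n. x i) = (\<Sum>i<k\<^sup>2. x i) + (\<Sum>i\<in>{k\<^sup>2..<n}. x i)"
      using k(1) by (simp add: lessThan_atLeast0 sum.atLeastLessThan_concat)
    moreover have "\<bar>\<Sum>i\<in>{k\<^sup>2..<n}. x i\<bar> \<le> (\<Sum>i\<in>{k\<^sup>2..<n}. 1)"
      by (rule order_trans[OF sum_abs sum_mono[OF bound]])
    then have "\<bar>\<Sum>i\<in>{k\<^sup>2..<n}. x i\<bar> \<le> real (2 * k)"
      using \<open>n - k\<^sup>2 \<le> 2 * k\<close> by simp
    ultimately have "\<bar>\<Sum>i<n. x i\<bar> \<le> \<bar>\<Sum>i<k\<^sup>2. x i\<bar> + 2 * real k"
      by simp
    then have "norm ((\<Sum>i<n. x i) / real n) \<le> (\<bar>\<Sum>i<k\<^sup>2. x i\<bar> + 2 * real k) / real n"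
      by (simp add: divide_right_mono)
    also have "\<dots> \<le> (\<bar>\<Sum>i<k\<^sup>2. x i\<bar> + 2 * real k) / real (k\<^sup>2)"
      using k(1) \<open>k > 0\<close> \<open>1 \<le> n\<close> by (intro divide_left_mono mult_pos_pos) (auto simp flip: of_nat_power)
    also have "\<dots> = T k"
      using \<open>k > 0\<close> by (simp add: T_def add_divide_distrib power2_eq_square)
    finally show "norm ((\<Sum>i<n. x i) / real n) \<le> T (floor_sqrt n)"
      by (simp add: k_def)
  qed
qed

text \<open>Each power of \<open>r\<close> occurs for four consecutive \<open>d\<close>, which gives
  four geometric series.\<close>

lemma sum_geometric_div4_le:
  fixes r :: real
  assumes "0 \<le> r" "r < 1"
  shows "(\<Sum>d<N. r ^ (d div 4)) \<le> 4 / (1 - r)"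
proof -
  have "(\<Sum>d<4 * N. r ^ (d div 4)) = 4 * (\<Sum>i<N. r ^ i)"
  proof (induction N)
    case (Suc N)
    have "4 * Suc N = Suc (Suc (Suc (Suc (4 * N))))" by simp
    moreover have "Suc (4 * N) div 4 = N" "Suc (Suc (4 * N)) div 4 = N" "Suc (Suc (Suc (4 * N))) div 4 = N"
      by presburger+
    ultimately have "(\<Sum>d<4 * Suc N. r ^ (d div 4)) = (\<Sum>d<4 * N. r ^ (d div 4)) + 4 * r ^ N"
      by (simp only: sum.lessThan_Suc) simp
    with Suc show ?case by simp
  qed simp
  moreover have "(\<Sum>d<N. r ^ (d div 4)) \<le> (\<Sum>d<4 * N. r ^ (d div 4))"
    using assms by (intro sum_mono2) auto
  moreover have "(\<Sum>i<N. r ^ i) \<le> 1 / (1 - r)"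
    using sum_le_suminf[of "\<lambda>i. r ^ i" "{..<N}"] assms
    by (simp add: summable_geometric suminf_geometric)
  ultimately show ?thesis by simp
qed

text \<open>Each sign is 1 minus twice the indicator of the support; the sum over
  \<open>i < Suc n\<close> matches the window \<open>{0..n}\<close>.\<close>

lemma has_natural_density_half:
  assumes "(\<lambda>n. (\<Sum>i<n. bit_sign (inv_coeff a i)) / real n) \<longlonglongrightarrow> 0"
  shows "has_natural_density (inverse_support a) (1 / 2)"
proof -
  have *: "real (card (inverse_support a \<inter> {0..n}))
      = (real (Suc n) - (\<Sum>i<Suc n. bit_sign (inv_coeff a i))) / 2" for n
  proof -
    have "(\<Sum>i<Suc n. bit_sign (inv_coeff a i))
        = (\<Sum>i<Suc n. 1 - 2 * indicator (inverse_support a) i)"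
      by (intro sum.cong) (auto simp: bit_sign_def inverse_support_def inv_coeff_def indicator_def)
    also have "\<dots> = real (Suc n) - 2 * (\<Sum>i<Suc n. indicator (inverse_support a) i)"
      by (simp add: sum_subtractf sum_distrib_left del: sum.lessThan_Suc)
    also have "(\<Sum>i<Suc n. indicator (inverse_support a) i)
        = real (card (inverse_support a \<inter> {0..n}))"
      by (simp add: indicator_def atLeast0AtMost lessThan_Suc_atMost Int_commute
          del: sum.lessThan_Suc)
    finally show ?thesis by simp
  qed
  have "(\<lambda>n. (1 - (\<Sum>i<Suc n. bit_sign (inv_coeff a i)) / real (Suc n)) / 2) \<longlonglongrightarrow> (1 - 0) / 2"
    by (intro tendsto_intros LIMSEQ_Suc[OF assms]) simp
  moreover have "real (card (inverse_support a \<inter> {0..n})) / (real n + 1)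
      = (1 - (\<Sum>i<Suc n. bit_sign (inv_coeff a i)) / real (Suc n)) / 2" for n
    unfolding * by (simp add: field_simps del: sum.lessThan_Suc)
  ultimately show ?thesis by (simp only: has_natural_density_def diff_zero)
qed

section \<open>Decorrelation\<close>

text \<open>All conditions start at index 1, because the constant term is fixed; \<open>f 0\<close>
  may even fail to be measurable.\<close>

locale biased_bits = prob_space +
  fixes f :: "nat \<Rightarrow> 'a \<Rightarrow> bit" and c :: real
  assumes indep: "indep_vars (\<lambda>_. count_space UNIV) f {1..}"
    and c_pos: "0 < c"
    and bias0: "\<And>n. 1 \<le> n \<Longrightarrow> c \<le> prob {\<omega> \<in> space M. f n \<omega> = 0}"
    and bias1: "\<And>n. 1 \<le> n \<Longrightarrow> c \<le> prob {\<omega> \<in> space M. f n \<omega> = 1}"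
begin

abbreviation sample :: "'a \<Rightarrow> nat \<Rightarrow> bit" where
  "sample \<omega> \<equiv> \<lambda>n. f n \<omega>"

section \<open>Means of single signs and of products\<close>

lemma measurable_bit [measurable (raw)]:
  "1 \<le> n \<Longrightarrow> f n \<in> measurable M (count_space UNIV)"
  using indep by (auto simp: indep_vars_def)

lemma prob_0_plus_prob_1:
  assumes "1 \<le> n"
  shows "prob {\<omega> \<in> space M. f n \<omega> = 0} + prob {\<omega> \<in> space M. f n \<omega> = 1} = 1"
proof -
  have [measurable]: "f n \<in> measurable M (count_space UNIV)"
    using assms by (rule measurable_bit)
  have "prob {\<omega> \<in> space M. f n \<omega> = 0} + prob {\<omega> \<in> space M. f n \<omega> = 1}
      = prob ({\<omega> \<in> space M. f n \<omega> = 0} \<union> {\<omega> \<in> space M. f n \<omega> = 1})"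
    by (rule finite_measure_Union[symmetric]) auto
  also have "{\<omega> \<in> space M. f n \<omega> = 0} \<union> {\<omega> \<in> space M. f n \<omega> = 1} = space M"
    by auto
  finally show ?thesis by (simp add: prob_space)
qed

lemma c_le_half: "c \<le> 1 / 2"
  using bias0[of 1] bias1[of 1] prob_0_plus_prob_1[of 1] by simp

text \<open>The mean is \<open>1 - 2 * p\<close> with \<open>p\<close> the probability of the value
  1, and \<open>p\<close> lies between \<open>c\<close> and \<open>1 - c\<close>.\<close>

lemma abs_expectation_bit_sign:
  assumes "1 \<le> n"
  shows "\<bar>expectation (\<lambda>\<omega>. bit_sign (f n \<omega>))\<bar> \<le> 1 - 2 * c"
proof -
  let ?A = "{\<omega> \<in> space M. f n \<omega> = 1}"
  have [measurable]: "f n \<in> measurable M (count_space UNIV)"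
    using assms by (rule measurable_bit)
  have "expectation (\<lambda>\<omega>. bit_sign (f n \<omega>)) = expectation (\<lambda>\<omega>. 1 - 2 * indicator ?A \<omega>)"
    by (intro Bochner_Integration.integral_cong) (auto simp: bit_sign_def indicator_def)
  also have "\<dots> = 1 - 2 * prob ?A"
  proof -
    have "?A \<in> events" by measurable
    then have "integrable M (indicat_real ?A)" "expectation (indicat_real ?A) = prob ?A"
      by (auto simp: emeasure_eq_measure)
    then show ?thesis
      by (subst Bochner_Integration.integral_diff) (auto simp: prob_space)
  qed
  finally show ?thesis
    using bias0[OF assms] bias1[OF assms] prob_0_plus_prob_1[OF assms] by simp
qed

text \<open>One function per index lets indicators and signs share a product. A function of one bit
  takes at most two values, hence each factor is integrable.\<close>

lemma expectation_prod_bits: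
  fixes Z :: "nat \<Rightarrow> bit \<Rightarrow> real"
  assumes "finite J" "J \<subseteq> {1..}"
  shows "expectation (\<lambda>\<omega>. \<Prod>i\<in>J. Z i (f i \<omega>)) = (\<Prod>i\<in>J. expectation (\<lambda>\<omega>. Z i (f i \<omega>)))"
proof (cases "J = {}")
  case False
  have "indep_vars (\<lambda>_. count_space UNIV) f J"
    using indep assms(2) by (rule indep_vars_subset)
  then have "indep_vars (\<lambda>_. borel) (\<lambda>i \<omega>. Z i (f i \<omega>)) J"
    by (rule indep_vars_compose2) simp
  moreover have "integrable M (\<lambda>\<omega>. Z i (f i \<omega>))" if "i \<in> J" for i
  proof (rule integrable_const_bound)
    show "AE \<omega> in M. norm (Z i (f i \<omega>)) \<le> max \<bar>Z i 0\<bar> \<bar>Z i 1\<bar>"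
    proof (rule AE_I2)
      fix \<omega>
      show "norm (Z i (f i \<omega>)) \<le> max \<bar>Z i 0\<bar> \<bar>Z i 1\<bar>" by (cases "f i \<omega>") auto
    qed
    have "f i \<in> measurable M (count_space UNIV)"
      using that assms(2) by (intro measurable_bit) auto
    then show "(\<lambda>\<omega>. Z i (f i \<omega>)) \<in> borel_measurable M"
      by (rule measurable_compose) simp
  qed
  ultimately show ?thesis
    using assms(1) by (intro indep_vars_lebesgue_integral)
qed (simp add: prob_space)

section \<open>Conditioning on the first \<open>m\<close> bits\<close>

lemma measurable_truncate_sample:
  "(\<lambda>\<omega>. truncate_seq m (sample \<omega>)) \<in> measurable M (count_space (range (truncate_seq m)))"
proof (subst measurable_count_space_eq_countable,
    rule countable_finite[OF finite_range_truncate_seq], intro conjI ballI)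
  fix a assume a: "a \<in> range (truncate_seq m)"
  have "(\<lambda>\<omega>. truncate_seq m (sample \<omega>)) -` {a} \<inter> space M
      = {\<omega> \<in> space M. \<forall>i\<in>{1..m}. f i \<omega> = a i}"
    unfolding vimage_def Int_def singleton_iff mem_Collect_eq truncate_seq_eq_iff[OF a] by blast
  also have "\<dots> \<in> sets M"
  proof (rule sets.sets_Collect_finite_All)
    fix i assume "i \<in> {1..m}"
    then have [measurable]: "f i \<in> measurable M (count_space UNIV)"
      by (intro measurable_bit) simp
    show "{\<omega> \<in> space M. f i \<omega> = a i} \<in> sets M" by measurable
  qed simp
  finally show "(\<lambda>\<omega>. truncate_seq m (sample \<omega>)) -` {a} \<inter> space M \<in> sets M" .
qed auto

lemma integrable_truncate_sample:
  fixes g :: "(nat \<Rightarrow> bit) \<Rightarrow> real"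
  shows "integrable M (\<lambda>\<omega>. g (truncate_seq m (sample \<omega>)))"
proof (rule integrable_const_bound)
  show "AE \<omega> in M. norm (g (truncate_seq m (sample \<omega>))) \<le> Max ((\<lambda>a. \<bar>g a\<bar>) ` range (truncate_seq m))"
    by (intro AE_I2) (simp only: real_norm_def, intro Max_ge finite_imageI finite_range_truncate_seq, auto)
  show "(\<lambda>\<omega>. g (truncate_seq m (sample \<omega>))) \<in> borel_measurable M"
    by (rule measurable_compose[OF measurable_truncate_sample]) simp
qed

text \<open>The hypothesis says that \<open>g\<close> sees only the first \<open>m\<close> bits, so
  it takes finitely many values.\<close>

lemma integrable_finitary:
  fixes g :: "(nat \<Rightarrow> bit) \<Rightarrow> real"
  assumes "\<And>a. g (truncate_seq m a) = g a"
  shows "integrable M (\<lambda>\<omega>. g (sample \<omega>))"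
  using integrable_truncate_sample[of g m] by (simp add: assms)

text \<open>Given the first \<open>m\<close> bits, \<open>\<phi>\<close> and the index set \<open>K\<close> are constant and the signs indexed
  by \<open>K\<close> are independent. As finitely many histories occur, conditioning is a finite sum over
  the values \<open>a\<close> of the history, with indicator functions \<open>I a\<close>.\<close>

lemma abs_expectation_sign_prod_le:
  fixes \<phi> :: "(nat \<Rightarrow> bit) \<Rightarrow> real" and K :: "(nat \<Rightarrow> bit) \<Rightarrow> nat set"
  assumes fin: "\<And>a. finite (K a)" and K: "\<And>a. K a \<subseteq> {m<..}"
    and \<phi>_tr: "\<And>a. \<phi> (truncate_seq m a) = \<phi> a" and K_tr: "\<And>a. K (truncate_seq m a) = K a"
  shows "\<bar>expectation (\<lambda>\<omega>. \<phi> (sample \<omega>) * (\<Prod>k\<in>K (sample \<omega>). bit_sign (f k \<omega>)))\<bar>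
    \<le> expectation (\<lambda>\<omega>. \<bar>\<phi> (sample \<omega>)\<bar> * (1 - 2 * c) ^ card (K (sample \<omega>)))"
proof -
  define H where "H = range (truncate_seq m)"
  have finH: "finite H" unfolding H_def by (rule finite_range_truncate_seq)
  \<comment> \<open>The indicator of a history is written as a product over bits so that
    independence applies to it.\<close>
  define I where "I a \<omega> = (\<Prod>i\<in>{1..m}. of_bool (f i \<omega> = a i) :: real)" for a \<omega>
  have I_eq: "I a \<omega> = of_bool (truncate_seq m (sample \<omega>) = a)" if "a \<in> H" for a \<omega>
    using that unfolding I_def H_def by (simp add: truncate_seq_eq_iff)
  \<comment> \<open>Exactly one history occurs, so the weights \<open>I a \<omega>\<close> select
    its value. As \<open>\<omega>\<close> is fixed first, \<open>g\<close> and \<open>g'\<close> may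
    depend on it.\<close>
  have cond: "g (sample \<omega>) = (\<Sum>a\<in>H. I a \<omega> * g' a)"
    if "g (sample \<omega>) = g' (truncate_seq m (sample \<omega>))" for \<omega> and g g' :: "(nat \<Rightarrow> bit) \<Rightarrow> real"
  proof -
    have "(\<Sum>a\<in>H. I a \<omega> * g' a) = (\<Sum>a\<in>H. if a = truncate_seq m (sample \<omega>) then g' a else 0)"
      by (intro sum.cong) (auto simp: I_eq)
    also have "\<dots> = g' (truncate_seq m (sample \<omega>))"
      using finH by (subst sum.delta) (auto simp: H_def)
    finally show ?thesis using that by simp
  qed
  have factor: "expectation (\<lambda>\<omega>. I a \<omega> * (\<Prod>k\<in>K a. bit_sign (f k \<omega>)))
      = expectation (I a) * (\<Prod>k\<in>K a. expectation (\<lambda>\<omega>. bit_sign (f k \<omega>)))" for a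
  proof -
    \<comment> \<open>One family covers both kinds of factor: history indicators up to
      \<open>m\<close>, and signs above \<open>m\<close>, where \<open>K a\<close> lies.\<close>
    define Z :: "nat \<Rightarrow> bit \<Rightarrow> real"
      where "Z i x = (if i \<le> m then of_bool (x = a i) else bit_sign x)" for i x
    have disj: "{1..m} \<inter> K a = {}" using K[of a] by auto
    have pos: "{1..m} \<union> K a \<subseteq> {1..}" using K[of a] by auto
    have ZK: "Z k x = bit_sign x" if "k \<in> K a" for k x
      using K[of a] that by (auto simp: Z_def)
    have IZ: "(\<Prod>i\<in>{1..m}. Z i (f i \<omega>)) = I a \<omega>" for \<omega>
      unfolding I_def Z_def by (rule prod.cong) simp_all
    have "I a \<omega> * (\<Prod>k\<in>K a. bit_sign (f k \<omega>)) = (\<Prod>i\<in>{1..m} \<union> K a. Z i (f i \<omega>))" for \<omega>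
      using fin disj by (simp add: prod.union_disjoint IZ ZK flip: One_nat_def)
    then have "expectation (\<lambda>\<omega>. I a \<omega> * (\<Prod>k\<in>K a. bit_sign (f k \<omega>)))
        = (\<Prod>i\<in>{1..m} \<union> K a. expectation (\<lambda>\<omega>. Z i (f i \<omega>)))"
      using fin pos by (simp add: expectation_prod_bits)
    also have "\<dots> = (\<Prod>i\<in>{1..m}. expectation (\<lambda>\<omega>. Z i (f i \<omega>)))
        * (\<Prod>i\<in>K a. expectation (\<lambda>\<omega>. Z i (f i \<omega>)))"
      using fin disj by (subst prod.union_disjoint) auto
    also have "(\<Prod>i\<in>{1..m}. expectation (\<lambda>\<omega>. Z i (f i \<omega>))) = expectation (\<lambda>\<omega>. \<Prod>i\<in>{1..m}. Z i (f i \<omega>))"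
      by (rule expectation_prod_bits[symmetric]) auto
    also have "(\<lambda>\<omega>. \<Prod>i\<in>{1..m}. Z i (f i \<omega>)) = I a"
      by (simp add: IZ fun_eq_iff flip: One_nat_def)
    also have "(\<Prod>i\<in>K a. expectation (\<lambda>\<omega>. Z i (f i \<omega>))) = (\<Prod>i\<in>K a. expectation (\<lambda>\<omega>. bit_sign (f i \<omega>)))"
      by (simp add: ZK)
    finally show ?thesis .
  qed
  have sign_bound: "\<bar>\<Prod>k\<in>K a. expectation (\<lambda>\<omega>. bit_sign (f k \<omega>))\<bar> \<le> (1 - 2 * c) ^ card (K a)" for a
  proof -
    have "(\<Prod>k\<in>K a. \<bar>expectation (\<lambda>\<omega>. bit_sign (f k \<omega>))\<bar>) \<le> (\<Prod>k\<in>K a. 1 - 2 * c)"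
      using K[of a] by (intro prod_mono conjI abs_expectation_bit_sign) auto
    then show ?thesis by (simp add: abs_prod)
  qed
  have int_I: "integrable M (I a)" if "a \<in> H" for a
  proof -
    have "I a = (\<lambda>\<omega>. of_bool (truncate_seq m (sample \<omega>) = a))"
      using I_eq[OF that] by (simp add: fun_eq_iff)
    then show ?thesis by (simp add: integrable_truncate_sample[of "\<lambda>x. of_bool (x = a)"])
  qed
  have I_nonneg: "0 \<le> I a \<omega>" for a \<omega>
    unfolding I_def by (rule prod_nonneg) auto
  have int_IP: "integrable M (\<lambda>\<omega>. I a \<omega> * (\<Prod>k\<in>K a. bit_sign (f k \<omega>)))" if "a \<in> H" for a
  proof (rule Bochner_Integration.integrable_bound[OF int_I[OF that]])
    have "(\<lambda>\<omega>. bit_sign (f k \<omega>)) \<in> borel_measurable M" if "k \<in> K a" for k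
      using K[of a] that by (intro measurable_compose[OF measurable_bit]) auto
    then show "(\<lambda>\<omega>. I a \<omega> * (\<Prod>k\<in>K a. bit_sign (f k \<omega>))) \<in> borel_measurable M"
      using int_I[OF that] by (intro borel_measurable_times borel_measurable_prod) auto
  qed (auto simp: abs_mult abs_prod)
  have "expectation (\<lambda>\<omega>. \<phi> (sample \<omega>) * (\<Prod>k\<in>K (sample \<omega>). bit_sign (f k \<omega>)))
      = expectation (\<lambda>\<omega>. \<Sum>a\<in>H. \<phi> a * (I a \<omega> * (\<Prod>k\<in>K a. bit_sign (f k \<omega>))))"
  proof (rule Bochner_Integration.integral_cong[OF refl])
    fix \<omega>
    show "\<phi> (sample \<omega>) * (\<Prod>k\<in>K (sample \<omega>). bit_sign (f k \<omega>))
        = (\<Sum>a\<in>H. \<phi> a * (I a \<omega> * (\<Prod>k\<in>K a. bit_sign (f k \<omega>))))"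
      by (subst cond[of "\<lambda>a. \<phi> a * (\<Prod>k\<in>K a. bit_sign (f k \<omega>))" \<omega>
              "\<lambda>a. \<phi> a * (\<Prod>k\<in>K a. bit_sign (f k \<omega>))"])
         (simp_all add: \<phi>_tr K_tr mult_ac)
  qed
  also have "\<dots> = (\<Sum>a\<in>H. \<phi> a * (expectation (I a) * (\<Prod>k\<in>K a. expectation (\<lambda>\<omega>. bit_sign (f k \<omega>)))))"
    by (simp add: int_IP factor)
  also have "\<bar>\<dots>\<bar> \<le> (\<Sum>a\<in>H. \<bar>\<phi> a * (expectation (I a) * (\<Prod>k\<in>K a. expectation (\<lambda>\<omega>. bit_sign (f k \<omega>))))\<bar>)"
    by (rule sum_abs)
  also have "\<dots> \<le> (\<Sum>a\<in>H. expectation (I a) * (\<bar>\<phi> a\<bar> * (1 - 2 * c) ^ card (K a)))"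
  proof (rule sum_mono)
    fix a
    have "0 \<le> expectation (I a)" by (simp add: I_nonneg)
    then show "\<bar>\<phi> a * (expectation (I a) * (\<Prod>k\<in>K a. expectation (\<lambda>\<omega>. bit_sign (f k \<omega>))))\<bar>
        \<le> expectation (I a) * (\<bar>\<phi> a\<bar> * (1 - 2 * c) ^ card (K a))"
      using mult_left_mono[OF sign_bound[of a], of "expectation (I a) * \<bar>\<phi> a\<bar>"]
      by (simp add: abs_mult mult_ac)
  qed
  also have "\<dots> = expectation (\<lambda>\<omega>. \<Sum>a\<in>H. I a \<omega> * (\<bar>\<phi> a\<bar> * (1 - 2 * c) ^ card (K a)))"
    by (simp add: int_I)
  also have "\<dots> = expectation (\<lambda>\<omega>. \<bar>\<phi> (sample \<omega>)\<bar> * (1 - 2 * c) ^ card (K (sample \<omega>)))"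
    by (intro Bochner_Integration.integral_cong refl cond[symmetric]) (simp add: \<phi>_tr K_tr)
  finally show ?thesis .
qed

section \<open>Exponential decay of bias factors and correlations\<close>

definition bias_factor :: "nat \<Rightarrow> (nat \<Rightarrow> bit) \<Rightarrow> real" where
  "bias_factor L a = (1 - 2 * c) ^ card {j. j < L \<and> inv_coeff a j = 1}"

text \<open>The sign of the truncated coefficient is known from the first \<open>m\<close> bits and
  joins \<open>\<phi>\<close>. Each \<open>j\<close> below \<open>(n - m + 1) div 2\<close> with
  inverse coefficient 1 adds a fresh independent sign, worth one factor
  \<open>1 - 2 * c\<close>.\<close>

lemma abs_expectation_sign_inv_coeff_le:
  fixes \<phi> :: "(nat \<Rightarrow> bit) \<Rightarrow> real"
  assumes n: "m < n" "n \<le> 2 * m + 1"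
    and \<phi>_tr: "\<And>a. \<phi> (truncate_seq m a) = \<phi> a"
  shows "\<bar>expectation (\<lambda>\<omega>. \<phi> (sample \<omega>) * bit_sign (inv_coeff (sample \<omega>) n))\<bar>
    \<le> expectation (\<lambda>\<omega>. \<bar>\<phi> (sample \<omega>)\<bar> * bias_factor ((n - m + 1) div 2) (sample \<omega>))"
proof -
  define J where "J a = {j. j < (n - m + 1) div 2 \<and> inv_coeff a j = 1}" for a
  define K where "K a = (\<lambda>j. n - 2 * j) ` J a" for a
  define \<psi> where "\<psi> a = \<phi> a * bit_sign (inv_coeff (truncate_seq m a) n)" for a
  have "inj_on (\<lambda>j. n - 2 * j) (J a)" for a
    by (auto simp: inj_on_def J_def)
  then have card_K: "card (K a) = card (J a)" for a
    unfolding K_def by (rule card_image)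
  have J_tr: "J (truncate_seq m a) = J a" for a
    using n by (auto simp: J_def inv_coeff_truncate_seq)
  have "\<bar>expectation (\<lambda>\<omega>. \<psi> (sample \<omega>) * (\<Prod>k\<in>K (sample \<omega>). bit_sign (f k \<omega>)))\<bar>
    \<le> expectation (\<lambda>\<omega>. \<bar>\<psi> (sample \<omega>)\<bar> * (1 - 2 * c) ^ card (K (sample \<omega>)))"
  proof (rule abs_expectation_sign_prod_le[where m = m])
    show "K a \<subseteq> {m<..}" for a by (auto simp: K_def J_def)
    show "finite (K a)" for a by (simp add: K_def J_def)
  qed (simp_all add: \<psi>_def K_def J_tr \<phi>_tr)
  moreover have "\<phi> (sample \<omega>) * bit_sign (inv_coeff (sample \<omega>) n)
      = \<psi> (sample \<omega>) * (\<Prod>k\<in>K (sample \<omega>). bit_sign (f k \<omega>))" for \<omega>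
    by (simp only: \<psi>_def K_def J_def bit_sign_inv_coeff_split[OF n, of "sample \<omega>"] mult.assoc)
  moreover have "\<bar>\<psi> a\<bar> * (1 - 2 * c) ^ card (K a) = \<bar>\<phi> a\<bar> * bias_factor ((n - m + 1) div 2) a" for a
    by (simp only: \<psi>_def card_K bias_factor_def J_def abs_mult abs_bit_sign mult_1_right)
  ultimately show ?thesis by (simp only:)
qed

lemma bias_factor_truncate_seq: "L \<le> Suc m \<Longrightarrow> bias_factor L (truncate_seq m a) = bias_factor L a"
  unfolding bias_factor_def
  by (intro arg_cong[of _ _ "\<lambda>S. (1 - 2 * c) ^ card S"]) (auto simp: inv_coeff_truncate_seq)

lemma bias_factor_nonneg: "0 \<le> bias_factor L a"
  using c_le_half by (simp add: bias_factor_def)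

lemma bias_factor_1: "bias_factor (Suc 0) a = 1 - 2 * c"
proof -
  have "{j. j < Suc 0 \<and> inv_coeff a j = 1} = {0}" by auto
  then show ?thesis by (simp add: bias_factor_def)
qed

text \<open>The weight \<open>(1 - c) + c * s\<close> is 1 at \<open>s = 1\<close> and
  \<open>1 - 2 * c\<close> at \<open>s = -1\<close>; being linear in the sign, it reduces the
  induction to a correlation bound.\<close>

lemma bias_factor_Suc:
  "bias_factor (Suc L) a = (1 - c) * bias_factor L a + c * (bias_factor L a * bit_sign (inv_coeff a L))"
proof (cases "inv_coeff a L = 1")
  case True
  then have "{j. j < Suc L \<and> inv_coeff a j = 1} = insert L {j. j < L \<and> inv_coeff a j = 1}"
    by (auto simp: less_Suc_eq)
  then show ?thesis
    using True by (simp add: bias_factor_def bit_sign_def algebra_simps)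
next
  case False
  then have "{j. j < Suc L \<and> inv_coeff a j = 1} = {j. j < L \<and> inv_coeff a j = 1}"
    by (auto simp: less_Suc_eq)
  then show ?thesis
    using False by (simp add: bias_factor_def bit_sign_def algebra_simps)
qed

text \<open>Everything follows from \<open>0 < c\<close> and
  \<open>2 * c^2 \<le> c \<le> 1 / 2\<close>.\<close>

lemma decay_rate_bounds: "0 \<le> 1 - 2 * c\<^sup>2" "1 - 2 * c\<^sup>2 < 1" "1 - 2 * c \<le> 1 - 2 * c\<^sup>2"
proof -
  have "c * c \<le> c * (1 / 2)" using c_le_half c_pos by (intro mult_left_mono) auto
  then have "2 * (c * c) \<le> c" by simp
  then show "0 \<le> 1 - 2 * c\<^sup>2" "1 - 2 * c\<^sup>2 < 1" "1 - 2 * c \<le> 1 - 2 * c\<^sup>2"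
    unfolding power2_eq_square using mult_pos_pos[OF c_pos c_pos] c_le_half by linarith+
qed

text \<open>Given the first \<open>L - 1\<close> bits, the coefficient at \<open>L\<close> still
  contains the fresh bit \<open>f L\<close>, so a step costs the factor
  \<open>(1 - c) + c * (1 - 2 * c) = 1 - 2 * c^2\<close>.\<close>

lemma expectation_bias_factor_le:
  assumes "1 \<le> L"
  shows "expectation (\<lambda>\<omega>. bias_factor L (sample \<omega>)) \<le> (1 - 2 * c\<^sup>2) ^ L"
  using assms
proof (induction L rule: dec_induct)
  case base
  then show ?case using decay_rate_bounds by (simp add: bias_factor_1 prob_space)
next
  case (step L)
  let ?B = "\<lambda>\<omega>. bias_factor L (sample \<omega>)"
  let ?s = "\<lambda>\<omega>. bit_sign (inv_coeff (sample \<omega>) L)"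
  \<comment> \<open>With \<open>m = L - 1\<close> only \<open>j = 0\<close> counts, and the constant
    coefficient of the inverse is always 1.\<close>
  have "\<bar>expectation (\<lambda>\<omega>. ?B \<omega> * ?s \<omega>)\<bar>
      \<le> expectation (\<lambda>\<omega>. \<bar>?B \<omega>\<bar> * bias_factor ((L - (L - 1) + 1) div 2) (sample \<omega>))"
    using step.hyps by (intro abs_expectation_sign_inv_coeff_le bias_factor_truncate_seq) auto
  also have "(L - (L - 1) + 1) div 2 = Suc 0" using step.hyps by simp
  finally have "\<bar>expectation (\<lambda>\<omega>. ?B \<omega> * ?s \<omega>)\<bar> \<le> expectation ?B * (1 - 2 * c)"
    by (simp add: bias_factor_1 bias_factor_nonneg)
  then have corr: "expectation (\<lambda>\<omega>. ?B \<omega> * ?s \<omega>) \<le> expectation ?B * (1 - 2 * c)"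
    by simp
  have "integrable M ?B"
    by (rule integrable_finitary[of _ L]) (simp add: bias_factor_truncate_seq)
  moreover have "integrable M (\<lambda>\<omega>. ?B \<omega> * ?s \<omega>)"
    by (rule integrable_finitary[of "\<lambda>a. bias_factor L a * bit_sign (inv_coeff a L)" L])
       (simp add: bias_factor_truncate_seq inv_coeff_truncate_seq)
  ultimately have "expectation (\<lambda>\<omega>. bias_factor (Suc L) (sample \<omega>))
      = (1 - c) * expectation ?B + c * expectation (\<lambda>\<omega>. ?B \<omega> * ?s \<omega>)"
    by (simp add: bias_factor_Suc)
  also have "\<dots> \<le> (1 - c) * expectation ?B + c * (expectation ?B * (1 - 2 * c))"
    using corr c_pos by (intro add_left_mono mult_left_mono) auto
  also have "\<dots> = (1 - 2 * c\<^sup>2) * expectation ?B"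
    by (simp add: algebra_simps power2_eq_square)
  also have "\<dots> \<le> (1 - 2 * c\<^sup>2) * (1 - 2 * c\<^sup>2) ^ L"
    using step.IH decay_rate_bounds by (intro mult_left_mono) auto
  finally show ?case by simp
qed

lemma expectation_sign_mult_le:
  assumes "i < j"
  shows "expectation (\<lambda>\<omega>. bit_sign (inv_coeff (sample \<omega>) i) * bit_sign (inv_coeff (sample \<omega>) j))
    \<le> (1 - 2 * c\<^sup>2) ^ ((j - i) div 4)"
proof -
  define m where "m = (i + j) div 2"
  \<comment> \<open>The midpoint keeps the sign at \<open>i\<close> within the history and leaves
    \<open>j - m\<close> at least half of \<open>j - i\<close>; halving again explains the
    \<open>div 4\<close>.\<close>
  have m: "i \<le> m" "m < j" "j \<le> 2 * m + 1" "(j - i) div 4 \<le> (j - m + 1) div 2" "1 \<le> (j - m + 1) div 2"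
    using assms unfolding m_def by auto
  have "expectation (\<lambda>\<omega>. bit_sign (inv_coeff (sample \<omega>) i) * bit_sign (inv_coeff (sample \<omega>) j))
    \<le> expectation (\<lambda>\<omega>. \<bar>bit_sign (inv_coeff (sample \<omega>) i)\<bar> * bias_factor ((j - m + 1) div 2) (sample \<omega>))"
    by (rule order_trans[OF abs_ge_self abs_expectation_sign_inv_coeff_le])
       (use m in \<open>simp_all add: inv_coeff_truncate_seq\<close>)
  also have "\<dots> \<le> (1 - 2 * c\<^sup>2) ^ ((j - m + 1) div 2)"
    using expectation_bias_factor_le[OF m(5)] by simp
  also have "\<dots> \<le> (1 - 2 * c\<^sup>2) ^ ((j - i) div 4)"
    using decay_rate_bounds m(4) by (intro power_decreasing) auto
  finally show ?thesis .
qed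

section \<open>Second moments and almost sure convergence\<close>

lemma integrable_sign_mult:
  "integrable M (\<lambda>\<omega>. bit_sign (inv_coeff (sample \<omega>) i) * bit_sign (inv_coeff (sample \<omega>) j))"
  by (rule integrable_finitary[of "\<lambda>a. bit_sign (inv_coeff a i) * bit_sign (inv_coeff a j)" "max i j"])
     (simp add: inv_coeff_truncate_seq)

lemma second_moment_le:
  "expectation (\<lambda>\<omega>. (\<Sum>i<N. bit_sign (inv_coeff (sample \<omega>) i))\<^sup>2) \<le> 4 / c\<^sup>2 * real N"
proof -
  define r where "r = 1 - 2 * c\<^sup>2"
  have r: "0 \<le> r" "r < 1" using decay_rate_bounds by (simp_all add: r_def)
  define e where "e i j = expectation (\<lambda>\<omega>. bit_sign (inv_coeff (sample \<omega>) i) * bit_sign (inv_coeff (sample \<omega>) j))" for i j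
  have e_le: "e i j \<le> r ^ ((j - i) div 4)" if "i \<le> j" for i j
  proof (cases "i = j")
    case True
    have "bit_sign x * bit_sign x = 1" for x by (simp add: bit_sign_def)
    then show ?thesis using True by (simp add: e_def prob_space)
  next
    case False
    then show ?thesis using that expectation_sign_mult_le[of i j] by (simp add: e_def r_def)
  qed
  have e_comm: "e i j = e j i" for i j
    by (simp add: e_def mult.commute)
  have e_row_sum: "(\<Sum>j<N. e i j) \<le> 8 / (1 - r)" if "i < N" for i
  proof -
    \<comment> \<open>The diagonal term falls into the second part, with exponent 0; each part is
      dominated by a geometric sum.\<close>
    have "(\<Sum>j<N. e i j) = (\<Sum>j<i. e i j) + (\<Sum>j\<in>{i..<N}. e i j)"
      using that by (simp add: lessThan_atLeast0 sum.atLeastLessThan_concat)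
    also have "(\<Sum>j<i. e i j) \<le> (\<Sum>j<i. r ^ ((i - j) div 4))"
      by (rule sum_mono) (subst e_comm, rule e_le, simp)
    also have "\<dots> \<le> (\<Sum>d<Suc i. r ^ (d div 4))"
    proof -
      have "(\<Sum>j<i. r ^ ((i - j) div 4)) = (\<Sum>d\<in>{1..i}. r ^ (d div 4))"
        by (rule sum.reindex_bij_witness[of _ "\<lambda>d. i - d" "\<lambda>j. i - j"]) auto
      also have "\<dots> \<le> (\<Sum>d<Suc i. r ^ (d div 4))"
        using r by (intro sum_mono2) auto
      finally show ?thesis .
    qed
    also have "\<dots> \<le> 4 / (1 - r)" using r by (rule sum_geometric_div4_le)
    also have "(\<Sum>j\<in>{i..<N}. e i j) \<le> (\<Sum>j\<in>{i..<N}. r ^ ((j - i) div 4))"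
      by (rule sum_mono) (rule e_le, simp)
    also have "\<dots> = (\<Sum>d<N - i. r ^ (d div 4))"
      by (rule sum.reindex_bij_witness[of _ "\<lambda>d. d + i" "\<lambda>j. j - i"]) auto
    also have "\<dots> \<le> 4 / (1 - r)" using r by (rule sum_geometric_div4_le)
    finally show ?thesis by simp
  qed
  have "expectation (\<lambda>\<omega>. (\<Sum>i<N. bit_sign (inv_coeff (sample \<omega>) i))\<^sup>2)
      = (\<Sum>i<N. \<Sum>j<N. e i j)"
    unfolding power2_eq_square sum_product e_def by (simp add: integrable_sign_mult)
  also have "\<dots> \<le> (\<Sum>i<N. 8 / (1 - r))"
    using e_row_sum by (intro sum_mono) auto
  \<comment> \<open>Here \<open>1 - r = 2 * c^2\<close>.\<close>
  also have "\<dots> = 4 / c\<^sup>2 * real N"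
    by (simp add: r_def)
  finally show ?thesis .
qed

text \<open>Squared averages along \<open>k^2\<close> have means of order \<open>1 / k^2\<close>, so
  their sum has finite mean, converges almost surely, and its terms tend to 0.\<close>

lemma AE_average_sign_squares:
  "AE \<omega> in M. (\<lambda>k. (\<Sum>i<k\<^sup>2. bit_sign (inv_coeff (sample \<omega>) i)) / real (k\<^sup>2)) \<longlonglongrightarrow> 0"
proof -
  define Z where "Z k \<omega> = ((\<Sum>i<k\<^sup>2. bit_sign (inv_coeff (sample \<omega>) i)) / real (k\<^sup>2))\<^sup>2" for k \<omega>
  have Z_nonneg: "0 \<le> Z k \<omega>" for k \<omega>
    by (simp add: Z_def)
  have int_Z: "integrable M (Z k)" for k
  proof -
    have "integrable M (\<lambda>\<omega>. (\<lambda>a. ((\<Sum>i<k\<^sup>2. bit_sign (inv_coeff a i)) / real (k\<^sup>2))\<^sup>2) (sample \<omega>))"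
      by (rule integrable_finitary[of _ "k\<^sup>2"]) (simp add: inv_coeff_truncate_seq)
    then show ?thesis by (simp add: Z_def[abs_def])
  qed
  have E_Z: "expectation (Z k) \<le> 4 / c\<^sup>2 * inverse (real k ^ 2)" for k
  \<comment> \<open>At \<open>k = 0\<close> both sides are 0, since division by 0 yields 0.\<close>
  proof (cases "k = 0")
    case False
    have "expectation (Z k) = expectation (\<lambda>\<omega>. (\<Sum>i<k\<^sup>2. bit_sign (inv_coeff (sample \<omega>) i))\<^sup>2) / (real (k\<^sup>2))\<^sup>2"
      by (simp add: Z_def[abs_def] power_divide)
    also have "\<dots> \<le> (4 / c\<^sup>2 * real (k\<^sup>2)) / (real (k\<^sup>2))\<^sup>2"
      by (intro divide_right_mono second_moment_le) auto
    also have "\<dots> = 4 / c\<^sup>2 * inverse (real k ^ 2)"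
      using False by (simp add: field_simps power2_eq_square)
    finally show ?thesis .
  qed (simp add: Z_def[abs_def])
  have "summable (\<lambda>k. 4 / c\<^sup>2 * inverse (real k ^ 2))"
    by (intro summable_mult inverse_power_summable) simp
  then have "summable (\<lambda>k. expectation (Z k))"
    by (rule summable_comparison_test'[where N = 0])
       (use E_Z in \<open>auto simp: Z_nonneg intro!: Bochner_Integration.integral_nonneg\<close>)
  have "(\<integral>\<^sup>+\<omega>. (\<Sum>k. ennreal (Z k \<omega>)) \<partial>M) = (\<Sum>k. \<integral>\<^sup>+\<omega>. ennreal (Z k \<omega>) \<partial>M)"
    using int_Z by (intro nn_integral_suminf) auto
  also have "\<dots> = (\<Sum>k. ennreal (expectation (Z k)))"
    using int_Z by (intro suminf_cong nn_integral_eq_integral) (auto simp: Z_nonneg)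
  also have "\<dots> = ennreal (\<Sum>k. expectation (Z k))"
    using \<open>summable (\<lambda>k. expectation (Z k))\<close>
    by (intro suminf_ennreal2) (auto simp: Z_nonneg)
  finally have "(\<integral>\<^sup>+\<omega>. (\<Sum>k. ennreal (Z k \<omega>)) \<partial>M) \<noteq> \<infinity>" by simp
  moreover have [measurable]: "Z k \<in> borel_measurable M" for k
    using int_Z by (rule borel_measurable_integrable)
  have "(\<lambda>\<omega>. \<Sum>k. ennreal (Z k \<omega>)) \<in> borel_measurable M"
    by measurable
  ultimately have "AE \<omega> in M. (\<Sum>k. ennreal (Z k \<omega>)) \<noteq> \<infinity>"
    by (intro nn_integral_noteq_infinite)
  then show ?thesis
  proof eventually_elim
    fix \<omega> assume "(\<Sum>k. ennreal (Z k \<omega>)) \<noteq> \<infinity>"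
    then have "summable (\<lambda>k. Z k \<omega>)"
      by (intro summable_suminf_not_top) (auto simp: Z_nonneg)
    then have "(\<lambda>k. Z k \<omega>) \<longlonglongrightarrow> 0" by (rule summable_LIMSEQ_zero)
    then show "(\<lambda>k. (\<Sum>i<k\<^sup>2. bit_sign (inv_coeff (sample \<omega>) i)) / real (k\<^sup>2)) \<longlonglongrightarrow> 0"
      unfolding Z_def by (simp add: power_tendsto_0_iff)
  qed
qed

lemma AE_has_natural_density_half:
  "AE \<omega> in M. has_natural_density (inverse_support (sample \<omega>)) (1 / 2)"
  using AE_average_sign_squares
proof eventually_elim
  fix \<omega>
  assume "(\<lambda>k. (\<Sum>i<k\<^sup>2. bit_sign (inv_coeff (sample \<omega>) i)) / real (k\<^sup>2)) \<longlonglongrightarrow> 0"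
  then show "has_natural_density (inverse_support (sample \<omega>)) (1 / 2)"
    by (intro has_natural_density_half average_tendsto_0_of_squares) auto
qed

end

theorem theorem3p1:
  fixes M :: "'a measure" and f :: "nat \<Rightarrow> 'a \<Rightarrow> bit"
  assumes "prob_space M"
    and "prob_space.indep_vars M (\<lambda>_. count_space UNIV) f {1..}"
    and "(INF n\<in>{1..}. min (measure M {\<omega> \<in> space M. f n \<omega> = 0})
                          (measure M {\<omega> \<in> space M. f n \<omega> = 1})) > 0"
  shows "AE \<omega> in M. has_natural_density (inverse_support (\<lambda>n. f n \<omega>)) (1 / 2)"
proof -
  let ?p = "\<lambda>n. min (measure M {\<omega> \<in> space M. f n \<omega> = 0}) (measure M {\<omega> \<in> space M. f n \<omega> = 1})"
  interpret prob_space M by fact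
  \<comment> \<open>For reals the infimum is a lower bound only of a set bounded below;
    probabilities are at least 0.\<close>
  have "bdd_below (?p ` {1..})"
    by (rule bdd_belowI[of _ 0]) auto
  then have "(INF n\<in>{1..}. ?p n) \<le> ?p n" if "1 \<le> n" for n
    using that by (intro cINF_lower) auto
  then interpret biased_bits M f "INF n\<in>{1..}. ?p n"
    using assms by unfold_locales auto
  show ?thesis by (rule AE_has_natural_density_half)
qed

end
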